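(* Let $\mathbf{a}\in\mathbb{R}^n$, let $\boldsymbol{g}=(g_1,\ldots,g_k)$, $\mathbf{h}=(h_1,\ldots,h_s)$ and $F=(f_1,\ldots,f_n)$ be sequences of polynomials in $\mathbb{R}[x_1,\ldots,x_n]$. Let $r_1,\ldots,r_p$ be polynomial invariants of the loop with trivial guard $\mathcal{L}(\mathbf{a},0,F)$. Then the semi-algebraic loop $\mathcal{L}(\mathbf{a},(\boldsymbol{g},\mathbf{h}),F)$ never terminates if $$\mathbf{V}(r_1,\ldots,r_p)\cap\mathbb{R}^n\subset\mathcal{S}(\boldsymbol{g},\mathbf{h}).$$
   Context: $\mathbf{x}=(x_1,\ldots,x_n)$; $\mathbf{V}(r_1,\ldots,r_p)\subset\mathbb{C}^n$ is the common complex zero set; $F$ is identified with the polynomial map it defines; $F^0=\mathrm{id}$, $F^m=F\circ F^{m-1}$. Semi-algebraic loop: $\mathcal{L}(\mathbf{a},(\boldsymbol{g},\mathbf{h}),F)$ initializes $\mathbf{x}=\mathbf{a}$ and, while $g_1(\mathbf{x})=\cdots=g_k(\mathbf{x})=0$ and $h_1(\mathbf{x})>0,\ldots,h_s(\mathbf{x})>0$, performs $\mathbf{x}\leftarrow F(\mathbf{x})$. $\mathcal{S}(\boldsymbol{g},\mathbf{h})=\{x\in\mathbb{R}^n\mid g_1(x)=\cdots=g_k(x)=0,\ h_1(x)>0,\ldots,h_s(x)>0\}$. $\mathcal{L}(\mathbf{a},0,F)$ denotes the infinite loop (guard $0=0$, always true) which initializes $\mathbf{x}=\mathbf{a}$ and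 repeatedly performs $\mathbf{x}\leftarrow F(\mathbf{x})$. A polynomial $r$ is a polynomial invariant of it if $r(F^l(\mathbf{a}))=0$ for all $l\ge0$. *)

theory Defs
  imports
    "HOL-Analysis.Finite_Cartesian_Product"
    "HOL-Library.Poly_Mapping"
    "HOL-Library.While_Combinator"
begin

text \<open>
  Polynomials over \<open>'a\<close> in variables indexed by the finite type \<open>'n\<close>: finitely supported
  coefficient functions on monomials, a monomial being given by its exponents.
\<close>

type_synonym ('a, 'n) mpoly = "('n \<Rightarrow>\<^sub>0 nat) \<Rightarrow>\<^sub>0 'a"

definition peval :: "('a::comm_semiring_1, 'n::finite) mpoly \<Rightarrow> 'a ^ 'n \<Rightarrow> 'a" where
  "peval p x =
    (\<Sum>m\<in>Poly_Mapping.keys p.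
      Poly_Mapping.lookup p m * (\<Prod>i\<in>UNIV. (x $ i) ^ Poly_Mapping.lookup m i))"

definition poly_map :: "('a::comm_semiring_1, 'n::finite) mpoly ^ 'n \<Rightarrow> 'a ^ 'n \<Rightarrow> 'a ^ 'n" where
  "poly_map F x = (\<chi> i. peval (F $ i) x)"

text \<open>The inclusion of $\mathbf{R}^n$ into $\mathbf{C}^n$; its range plays the role of
  $\mathbf{R}^n$ as a subset of $\mathbf{C}^n$.\<close>

definition cvec :: "real ^ 'n \<Rightarrow> complex ^ 'n" where
  "cvec x = (\<chi> i. complex_of_real (x $ i))"

definition zero_set :: "(complex, 'n::finite) mpoly list \<Rightarrow> (complex ^ 'n) set" where
  "zero_set rs = {z. \<forall>r\<in>set rs. peval r z = 0}"

definition semialg_guard ::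
  "(real, 'n::finite) mpoly list \<Rightarrow> (real, 'n) mpoly list \<Rightarrow> real ^ 'n \<Rightarrow> bool" where
  "semialg_guard g h x \<longleftrightarrow> (\<forall>p\<in>set g. peval p x = 0) \<and> (\<forall>q\<in>set h. peval q x > 0)"

definition semialg_set ::
  "(real, 'n::finite) mpoly list \<Rightarrow> (real, 'n) mpoly list \<Rightarrow> (real ^ 'n) set" where
  "semialg_set g h = {x. semialg_guard g h x}"

text \<open>
  The result of running the loop: \<open>Some\<close> of the final state if the guard eventually fails,
  and \<open>None\<close> if the loop runs forever.
\<close>

definition semialg_loop ::
  "real ^ 'n \<Rightarrow> (real, 'n::finite) mpoly list \<Rightarrow> (real, 'n) mpoly list \<Rightarrow>
    (real, 'n) mpoly ^ 'n \<Rightarrow> (real ^ 'n) option" where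
  "semialg_loop a g h F = while_option (semialg_guard g h) (poly_map F) a"

definition never_terminates ::
  "real ^ 'n \<Rightarrow> (real, 'n::finite) mpoly list \<Rightarrow> (real, 'n) mpoly list \<Rightarrow>
    (real, 'n) mpoly ^ 'n \<Rightarrow> bool" where
  "never_terminates a g h F \<longleftrightarrow> semialg_loop a g h F = None"

text \<open>
  Polynomial invariants of the loop with trivial guard. They may have complex coefficients,
  so the real states of the loop are regarded as points of $\mathbf{C}^n$.
\<close>

definition poly_invariant ::
  "real ^ 'n \<Rightarrow> (real, 'n::finite) mpoly ^ 'n \<Rightarrow> (complex, 'n) mpoly \<Rightarrow> bool" where
  "poly_invariant a F r \<longleftrightarrow> (\<forall>l. peval r (cvec ((poly_map F ^^ l) a)) = 0)"

end

theory Submission imports Defs begin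

text \<open>Every state of the unguarded loop is a real common zero of the invariants, so by the
  inclusion it satisfies the guard. The guarded loop therefore follows the same orbit
  forever.\<close>

lemma inj_cvec: "inj cvec"
  by (auto simp: inj_def cvec_def vec_eq_iff)

theorem proposition6p3:
  fixes a :: "real ^ 'n::finite"
    and g h :: "(real, 'n) mpoly list"
    and F :: "(real, 'n) mpoly ^ 'n"
    and rs :: "(complex, 'n) mpoly list"
  assumes "\<forall>r\<in>set rs. poly_invariant a F r"
    and "zero_set rs \<inter> range cvec \<subseteq> cvec ` semialg_set g h"
  shows "never_terminates a g h F"
proof -
  have "semialg_guard g h ((poly_map F ^^ l) a)" for l
  proof -
    have "cvec ((poly_map F ^^ l) a) \<in> zero_set rs"
      using assms(1) by (auto simp: zero_set_def poly_invariant_def)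
    then have "cvec ((poly_map F ^^ l) a) \<in> cvec ` semialg_set g h"
      using assms(2) by blast
    \<comment> \<open>Injectivity of \<open>cvec\<close> pulls membership back from the image to the
      real state itself.\<close>
    then show ?thesis
      by (simp add: inj_image_mem_iff[OF inj_cvec] semialg_set_def)
  qed
  \<comment> \<open>By definition, \<open>while_option\<close> yields \<open>None\<close> exactly
    when no iterate violates the guard.\<close>
  then show ?thesis
    by (simp add: never_terminates_def semialg_loop_def while_option_def)
qed

end
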